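(* There is an absolute constant $C$ such that the following holds. Let $f\colon \{-1,1\}^n \to [-1,1]$ be a homogeneous function of degree $d$. Then \[ \mathrm{Inf}[f] \leq \|\Delta(f)\|_\infty \leq C d^{3/2}. \]
   Context: Every $f\colon\{-1,1\}^n\to\mathbb{R}$ has a unique multilinear polynomial representation; its degree is the degree of this polynomial, and $f$ is homogeneous if all its monomials (with nonzero coefficient) have the same degree. With $x\oplus e_i$ the point $x$ with $i$th coordinate flipped, $f_i(x)=\frac{f(x)-f(x\oplus e_i)}{2}$, $\Delta(f)(x)=\sum_{i=1}^n|f_i(x)|$, $\mathrm{Inf}[f]=\sum_i\mathbb{E}_x|f_i(x)|$ ($x$ uniform on $\{-1,1\}^n$), and $\|\Delta(f)\|_\infty=\max_x\Delta(f)(x)$. *)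

theory Defs
  imports "HOL-Probability.Probability"
begin

text \<open>
  The dimension \<open>n\<close> is quantified inside the theorem (under the absolute constant), so points of
  the cube \<open>{-1,1}\<^sup>n\<close> are extensional functions on the index set \<open>{..<n}\<close>, and a function on the
  cube is a total function of which only the values on \<open>cube n\<close> matter.
\<close>

definition cube :: "nat \<Rightarrow> (nat \<Rightarrow> real) set" where
  "cube n = {..<n} \<rightarrow>\<^sub>E {-1, 1}"

text \<open>
  A multilinear polynomial in \<open>n\<close> variables is given by its coefficients \<open>c S\<close>, where
  \<open>S \<subseteq> {..<n}\<close> stands for the monomial \<open>\<Prod>i\<in>S. x i\<close>, of degree \<open>card S\<close>.
\<close>

definition multilinear_rep :: "nat \<Rightarrow> ((nat \<Rightarrow> real) \<Rightarrow> real) \<Rightarrow> (nat set \<Rightarrow> real) \<Rightarrow> bool" where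
  "multilinear_rep n f c \<longleftrightarrow>
     (\<forall>S. \<not> S \<subseteq> {..<n} \<longrightarrow> c S = 0) \<and>
     (\<forall>x\<in>cube n. f x = (\<Sum>S\<in>Pow {..<n}. c S * (\<Prod>i\<in>S. x i)))"

text \<open>Existence and uniqueness are the lemma \<open>multilinear_rep_ex1\<close> below.\<close>

definition multilinear_coeff :: "nat \<Rightarrow> ((nat \<Rightarrow> real) \<Rightarrow> real) \<Rightarrow> nat set \<Rightarrow> real" where
  "multilinear_coeff n f = (THE c. multilinear_rep n f c)"

text \<open>As usual, the zero function is homogeneous of every degree.\<close>

definition homogeneous_of_degree :: "nat \<Rightarrow> nat \<Rightarrow> ((nat \<Rightarrow> real) \<Rightarrow> real) \<Rightarrow> bool" where
  "homogeneous_of_degree n d f \<longleftrightarrow> (\<forall>S. multilinear_coeff n f S \<noteq> 0 \<longrightarrow> card S = d)"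

definition flip :: "nat \<Rightarrow> (nat \<Rightarrow> real) \<Rightarrow> nat \<Rightarrow> real" where
  "flip i x = x(i := - x i)"

definition partial_diff :: "nat \<Rightarrow> ((nat \<Rightarrow> real) \<Rightarrow> real) \<Rightarrow> (nat \<Rightarrow> real) \<Rightarrow> real" where
  "partial_diff i f x = (f x - f (flip i x)) / 2"

definition Delta :: "nat \<Rightarrow> ((nat \<Rightarrow> real) \<Rightarrow> real) \<Rightarrow> (nat \<Rightarrow> real) \<Rightarrow> real" where
  "Delta n f x = (\<Sum>i<n. \<bar>partial_diff i f x\<bar>)"

definition Inf_total :: "nat \<Rightarrow> ((nat \<Rightarrow> real) \<Rightarrow> real) \<Rightarrow> real" where
  "Inf_total n f =
     (\<Sum>i<n. measure_pmf.expectation (pmf_of_set (cube n)) (\<lambda>x. \<bar>partial_diff i f x\<bar>))"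

definition sup_norm :: "nat \<Rightarrow> ((nat \<Rightarrow> real) \<Rightarrow> real) \<Rightarrow> real" where
  "sup_norm n g = Max ((\<lambda>x. \<bar>g x\<bar>) ` cube n)"

lemma finite_cube: "finite (cube n)"
  by (simp add: cube_def finite_PiE)

lemma cube_nonempty: "cube n \<noteq> {}"
  by (auto simp: cube_def PiE_eq_empty_iff)

lemma flip_cube: "x \<in> cube n \<Longrightarrow> i < n \<Longrightarrow> flip i x \<in> cube n"
  by (auto simp: cube_def flip_def PiE_iff extensional_def)

lemma cube_coord: "x \<in> cube n \<Longrightarrow> i < n \<Longrightarrow> x i = -1 \<or> x i = 1"
  by (auto simp: cube_def PiE_iff)

lemma cube_sq: "x \<in> cube n \<Longrightarrow> i < n \<Longrightarrow> x i * x i = 1"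
  using cube_coord[of x n i] by auto

lemma cube_characters_orthogonal:
  assumes "S \<subseteq> {..<n}" "T \<subseteq> {..<n}"
  shows "(\<Sum>x\<in>cube n. (\<Prod>i\<in>S. x i) * (\<Prod>i\<in>T. x i)) = (if S = T then 2 ^ n else 0)"
proof -
  define g where "g i v = (if i \<in> S then v else 1) * (if i \<in> T then v else (1::real))" for i v
  have restr: "(\<Prod>i<n. if i \<in> A then x i else 1) = (\<Prod>i\<in>A. x i)"
    if "A \<subseteq> {..<n}" for A and x :: "nat \<Rightarrow> real"
    using that by (simp add: prod.If_cases Int_absorb1)
  have "(\<Sum>x\<in>cube n. (\<Prod>i\<in>S. x i) * (\<Prod>i\<in>T. x i)) = (\<Sum>x\<in>cube n. \<Prod>i<n. g i (x i))"
    by (simp add: g_def prod.distrib restr[OF assms(1)] restr[OF assms(2)])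
  also have "\<dots> = (\<Prod>i<n. \<Sum>v\<in>{-1,1}. g i v)"
    unfolding cube_def by (rule prod_sum_PiE[symmetric]) auto
  also have "\<dots> = (\<Prod>i<n. if i \<in> S \<longleftrightarrow> i \<in> T then 2 else 0)"
    by (rule prod.cong) (auto simp: g_def)
  also have "\<dots> = (if S = T then 2 ^ n else 0)"
  proof (cases "S = T")
    case False
    then obtain i where "i < n" "\<not> (i \<in> S \<longleftrightarrow> i \<in> T)" using assms by blast
    then have "(\<Prod>i<n. if i \<in> S \<longleftrightarrow> i \<in> T then 2 else (0::real)) = 0"
      by (intro prod_zero) auto
    with False show ?thesis by simp
  qed simp
  finally show ?thesis .
qed

lemma cube_characters_complete:
  assumes x: "x \<in> cube n" and y: "y \<in> cube n"
  shows "(\<Sum>S\<in>Pow {..<n}. (\<Prod>i\<in>S. x i) * (\<Prod>i\<in>S. y i)) = (if x = y then 2 ^ n else 0)"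
proof -
  have "(\<Sum>S\<in>Pow {..<n}. (\<Prod>i\<in>S. x i) * (\<Prod>i\<in>S. y i)) = (\<Prod>i<n. x i * y i + 1)"
    by (subst prod_add) (simp_all add: prod.distrib)
  also have "\<dots> = (if x = y then 2 ^ n else 0)"
  proof (cases "x = y")
    case True
    then show ?thesis using cube_sq[OF y] by simp
  next
    case False
    then obtain i where i: "x i \<noteq> y i" by blast
    have "i < n" using x y i by (cases "i < n") (auto simp: cube_def PiE_iff extensional_def)
    moreover have "x i * y i + 1 = 0"
      using cube_coord[OF x \<open>i < n\<close>] cube_coord[OF y \<open>i < n\<close>] i by auto
    ultimately have "(\<Prod>i<n. x i * y i + 1) = 0" by (intro prod_zero) auto
    with False show ?thesis by simp
  qed
  finally show ?thesis .
qed

lemma multilinear_rep_coeff: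
  assumes "multilinear_rep n f c"
  shows "c S = (if S \<subseteq> {..<n} then (\<Sum>x\<in>cube n. f x * (\<Prod>i\<in>S. x i)) / 2 ^ n else 0)"
proof (cases "S \<subseteq> {..<n}")
  case True
  have "(\<Sum>x\<in>cube n. f x * (\<Prod>i\<in>S. x i))
      = (\<Sum>x\<in>cube n. \<Sum>T\<in>Pow {..<n}. c T * ((\<Prod>i\<in>T. x i) * (\<Prod>i\<in>S. x i)))"
    using assms by (intro sum.cong) (auto simp: multilinear_rep_def sum_distrib_right mult.assoc)
  also have "\<dots> = (\<Sum>T\<in>Pow {..<n}. c T * (\<Sum>x\<in>cube n. (\<Prod>i\<in>T. x i) * (\<Prod>i\<in>S. x i)))"
    by (subst sum.swap) (simp add: sum_distrib_left)
  also have "\<dots> = (\<Sum>T\<in>Pow {..<n}. if T = S then c S * 2 ^ n else 0)"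
    using True by (intro sum.cong) (auto simp: cube_characters_orthogonal)
  also have "\<dots> = c S * 2 ^ n" using True by (simp add: sum.delta)
  finally show ?thesis using True by simp
qed (use assms in \<open>auto simp: multilinear_rep_def\<close>)

lemma multilinear_rep_exists:
  "multilinear_rep n f
     (\<lambda>S. if S \<subseteq> {..<n} then (\<Sum>x\<in>cube n. f x * (\<Prod>i\<in>S. x i)) / 2 ^ n else 0)"
  unfolding multilinear_rep_def
proof (intro conjI allI impI ballI)
  fix y assume y: "y \<in> cube n"
  have "(\<Sum>S\<in>Pow {..<n}. (if S \<subseteq> {..<n} then (\<Sum>x\<in>cube n. f x * (\<Prod>i\<in>S. x i)) / 2 ^ n else 0)
          * (\<Prod>i\<in>S. y i))
      = (\<Sum>S\<in>Pow {..<n}. \<Sum>x\<in>cube n. f x / 2 ^ n * ((\<Prod>i\<in>S. x i) * (\<Prod>i\<in>S. y i)))"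
    by (intro sum.cong) (auto simp: sum_distrib_left sum_divide_distrib mult_ac)
  also have "\<dots> = (\<Sum>x\<in>cube n. f x / 2 ^ n * (\<Sum>S\<in>Pow {..<n}. (\<Prod>i\<in>S. x i) * (\<Prod>i\<in>S. y i)))"
    by (subst sum.swap) (simp add: sum_distrib_left)
  also have "\<dots> = (\<Sum>x\<in>cube n. if x = y then f y else 0)"
    using y by (intro sum.cong) (auto simp: cube_characters_complete)
  also have "\<dots> = f y" using y by (simp add: finite_cube)
  finally show "f y = (\<Sum>S\<in>Pow {..<n}.
      (if S \<subseteq> {..<n} then (\<Sum>x\<in>cube n. f x * (\<Prod>i\<in>S. x i)) / 2 ^ n else 0) * (\<Prod>i\<in>S. y i))"
    by simp
qed simp

lemma multilinear_rep_ex1: "\<exists>!c. multilinear_rep n f c"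
proof (rule ex1I)
  show "multilinear_rep n f
     (\<lambda>S. if S \<subseteq> {..<n} then (\<Sum>x\<in>cube n. f x * (\<Prod>i\<in>S. x i)) / 2 ^ n else 0)"
    by (rule multilinear_rep_exists)
qed (rule ext, rule multilinear_rep_coeff)

lemma multilinear_rep_multilinear_coeff: "multilinear_rep n f (multilinear_coeff n f)"
  unfolding multilinear_coeff_def by (rule theI'[OF multilinear_rep_ex1])

end

theory Submission
  imports Defs "HOL-Complex_Analysis.Complex_Analysis"
begin

text \<open>
  For \<open>x\<close> in the cube, \<open>\<Delta>(f)(x)\<close> is the maximum over sign vectors \<open>y\<close> of the directional
  derivative of the multilinear extension of \<open>f\<close> at \<open>x\<close> in direction \<open>y\<close>. That extension is bounded
  by \<open>r\<^sup>d\<close> on \<open>[-r,r]\<^sup>n\<close>. Every coordinate of \<open>cos \<theta> x + d\<^sup>-\<^sup>1\<^sup>/\<^sup>2 sin \<theta> y\<close> is at most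
  \<open>(1 + 1/d)\<^sup>1\<^sup>/\<^sup>2\<close> in absolute value, so \<open>f\<close> restricted to this ellipse is a trigonometric
  polynomial of degree \<open>d\<close> bounded by an absolute constant. Bernstein's inequality bounds its
  derivative at \<open>\<theta> = 0\<close>, which is \<open>d\<^sup>-\<^sup>1\<^sup>/\<^sup>2\<close> times the directional derivative, by \<open>O(d)\<close>.
\<close>

section \<open>Bernstein's inequality up to a constant\<close>

text \<open>Keeps two powers bounded: that of the modulus on Cauchy's circle of radius 1/d and that
  of the coordinate bound on the ellipse.\<close>

lemma one_plus_inverse_power_le_3:
  assumes "d > 0"
  shows "(1 + 1 / real d) ^ d \<le> 3"
proof -
  have "(1 + 1 / real d) ^ d \<le> exp (1 / real d) ^ d"
    by (intro power_mono) auto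
  also have "\<dots> = exp 1"
    using assms by (simp flip: exp_of_nat_mult)
  also have "\<dots> \<le> 3"
    by (rule exp_le)
  finally show ?thesis .
qed

lemma maximum_modulus_unit_disc:
  assumes "f holomorphic_on UNIV" and "\<And>z. norm z = 1 \<Longrightarrow> norm (f z) \<le> M" and "norm z \<le> 1"
  shows "norm (f z) \<le> M"
proof (rule maximum_modulus_frontier[of f "cball 0 1"])
  show "f holomorphic_on interior (cball 0 1)"
    by (rule holomorphic_on_subset[OF assms(1)]) simp
  show "continuous_on (closure (cball 0 1)) f"
    by (rule holomorphic_on_imp_continuous_on, rule holomorphic_on_subset[OF assms(1)]) simp
qed (use assms in auto)

text \<open>
  Bernstein's inequality up to a constant for the polynomial \<open>Q\<close> of degree \<open>d\<close>, whose reversal is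
  \<open>R\<close>: the maximum principle for \<open>R\<close> controls \<open>Q\<close> outside the unit disc, and Cauchy's estimate on
  the circle of radius \<open>1/d\<close> around \<open>1\<close> finishes.
\<close>

lemma Bernstein_inequality_reversal:
  fixes Q R :: "complex \<Rightarrow> complex"
  assumes Q: "Q holomorphic_on UNIV" and R: "R holomorphic_on UNIV" and d: "d > 0"
    and rev: "\<And>z. z \<noteq> 0 \<Longrightarrow> Q z = z ^ d * R (1 / z)"
    and QM: "\<And>z. norm z = 1 \<Longrightarrow> norm (Q z) \<le> M"
    and RM: "\<And>z. norm z = 1 \<Longrightarrow> norm (R z) \<le> M"
  shows "norm (deriv Q 1) \<le> 3 * M * real d"
proof -
  have M: "M \<ge> 0"
    using order_trans[OF norm_ge_zero QM[of 1]] by simp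
  have bound: "norm (Q z) \<le> 3 * M" if z: "norm (1 - z) = 1 / real d" for z
  proof (cases "norm z \<le> 1")
    case True
    then have "norm (Q z) \<le> M"
      using maximum_modulus_unit_disc[OF Q QM] by blast
    with M show ?thesis by simp
  next
    case False
    then have "z \<noteq> 0" by auto
    have "norm z \<le> 1 + 1 / real d"
      using z norm_triangle_ineq4[of 1 "1 - z"] by simp
    then have "norm z ^ d \<le> 3"
      using one_plus_inverse_power_le_3[OF d] by (meson norm_ge_zero order_trans power_mono)
    moreover have "norm (R (1 / z)) \<le> M"
      by (rule maximum_modulus_unit_disc[OF R RM]) (use False in \<open>simp_all add: norm_divide divide_le_eq\<close>)
    ultimately have "norm z ^ d * norm (R (1 / z)) \<le> 3 * M"
      by (intro mult_mono) auto
    then show ?thesis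
      using rev[OF \<open>z \<noteq> 0\<close>] by (simp add: norm_mult norm_power)
  qed
  have "norm ((deriv ^^ 1) Q 1) \<le> fact 1 * (3 * M) / (1 / real d) ^ 1"
  proof (rule Cauchy_inequality)
    show "Q holomorphic_on ball 1 (1 / real d)"
      by (rule holomorphic_on_subset[OF Q]) simp
    show "continuous_on (cball 1 (1 / real d)) Q"
      by (rule holomorphic_on_imp_continuous_on, rule holomorphic_on_subset[OF Q]) simp
  qed (use d bound in auto)
  then show ?thesis by simp
qed

section \<open>The multilinear extension and its bounds\<close>

text \<open>Polymorphic because bounds are proved at real points while differentiation takes place
  along complex curves.\<close>

definition multilinear_eval :: "nat \<Rightarrow> (nat set \<Rightarrow> real) \<Rightarrow> (nat \<Rightarrow> 'a::{real_algebra_1,comm_ring_1}) \<Rightarrow> 'a"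
  where "multilinear_eval n c z = (\<Sum>S\<in>Pow {..<n}. of_real (c S) * (\<Prod>i\<in>S. z i))"

lemma multilinear_eval_of_real:
  fixes z :: "nat \<Rightarrow> real"
  shows "multilinear_eval n c (\<lambda>i. of_real (z i) :: complex) = of_real (multilinear_eval n c z)"
  by (simp add: multilinear_eval_def)

lemma multilinear_eval_coeff:
  "x \<in> cube n \<Longrightarrow> multilinear_eval n (multilinear_coeff n f) x = f x"
  using multilinear_rep_multilinear_coeff[of n f]
  by (simp add: multilinear_rep_def multilinear_eval_def)

text \<open>Homogeneity acts in this form three times: it extracts a radius \<open>r\<close>, a
  phase \<open>cis t\<close>, and the factor \<open>z\<close> in the reversal of the
  polynomial.\<close>

lemma multilinear_eval_scale:
  assumes "\<And>S. c S \<noteq> 0 \<Longrightarrow> card S = d"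
  shows "multilinear_eval n c (\<lambda>i. w * z i) = w ^ d * multilinear_eval n c z"
proof -
  have "of_real (c S) * (\<Prod>i\<in>S. w * z i) = w ^ d * (of_real (c S) * (\<Prod>i\<in>S. z i))" for S
    using assms[of S] by (cases "c S = 0") (auto simp: prod.distrib mult_ac)
  then show ?thesis
    by (simp add: multilinear_eval_def sum_distrib_left)
qed

text \<open>
  On the solid cube, the multilinear extension is the average of \<open>f\<close> against the product measure
  with mean \<open>z\<close>.
\<close>

lemma multilinear_eval_average:
  fixes z :: "nat \<Rightarrow> real"
  shows "multilinear_eval n (multilinear_coeff n f) z
       = (\<Sum>x\<in>cube n. f x * (\<Prod>i<n. (1 + x i * z i) / 2))"
proof -
  have weight: "(\<Prod>i<n. (1 + x i * z i) / 2)
      = (\<Sum>S\<in>Pow {..<n}. (\<Prod>i\<in>S. x i) * (\<Prod>i\<in>S. z i)) / 2 ^ n" for x :: "nat \<Rightarrow> real"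
  proof -
    have "(\<Prod>i<n. x i * z i + 1) = (\<Sum>S\<in>Pow {..<n}. (\<Prod>i\<in>S. x i) * (\<Prod>i\<in>S. z i))"
      by (subst prod_add) (simp_all add: prod.distrib)
    then show ?thesis
      by (simp add: prod_dividef add.commute)
  qed
  have "multilinear_eval n (multilinear_coeff n f) z
      = (\<Sum>S\<in>Pow {..<n}. \<Sum>x\<in>cube n. f x * ((\<Prod>i\<in>S. x i) * (\<Prod>i\<in>S. z i)) / 2 ^ n)"
    unfolding multilinear_eval_def multilinear_rep_coeff[OF multilinear_rep_multilinear_coeff]
    by (intro sum.cong) (auto simp: sum_distrib_left sum_divide_distrib mult_ac)
  also have "\<dots> = (\<Sum>x\<in>cube n. f x * (\<Prod>i<n. (1 + x i * z i) / 2))"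
    by (subst sum.swap) (simp add: weight sum_distrib_left sum_divide_distrib)
  finally show ?thesis .
qed

text \<open>For \<open>z\<close> in the solid cube the weights in
  \<open>multilinear_eval_average\<close> are nonnegative and sum to 1, so the value is a convex
  combination of values of \<open>f\<close>.\<close>

lemma multilinear_eval_le_1:
  fixes z :: "nat \<Rightarrow> real"
  assumes f: "\<And>x. x \<in> cube n \<Longrightarrow> \<bar>f x\<bar> \<le> 1" and z: "\<And>i. i < n \<Longrightarrow> \<bar>z i\<bar> \<le> 1"
  shows "\<bar>multilinear_eval n (multilinear_coeff n f) z\<bar> \<le> 1"
proof -
  have pos: "(\<Prod>i<n. (1 + x i * z i) / 2) \<ge> 0" if "x \<in> cube n" for x
  proof (rule prod_nonneg)
    fix i assume "i \<in> {..<n}"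
    then show "(1 + x i * z i) / 2 \<ge> 0"
      using z[of i] cube_coord[OF that, of i] by auto
  qed
  have "\<bar>multilinear_eval n (multilinear_coeff n f) z\<bar>
      \<le> (\<Sum>x\<in>cube n. \<bar>f x * (\<Prod>i<n. (1 + x i * z i) / 2)\<bar>)"
    unfolding multilinear_eval_average by (rule sum_abs)
  also have "\<dots> \<le> (\<Sum>x\<in>cube n. \<Prod>i<n. (1 + x i * z i) / 2)"
    using f pos by (intro sum_mono) (auto simp: abs_mult intro: mult_left_le_one_le)
  also have "\<dots> = (\<Prod>i<n. \<Sum>v\<in>{-1,1}. (1 + v * z i) / 2)"
    unfolding cube_def by (rule prod_sum_PiE[symmetric]) auto
  also have "\<dots> = 1"
    by (simp add: field_simps)
  finally show ?thesis .
qed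

lemma multilinear_eval_le_power:
  fixes z :: "nat \<Rightarrow> real"
  assumes f: "\<And>x. x \<in> cube n \<Longrightarrow> \<bar>f x\<bar> \<le> 1" and hom: "homogeneous_of_degree n d f"
    and r: "r > 0" and z: "\<And>i. i < n \<Longrightarrow> \<bar>z i\<bar> \<le> r"
  shows "\<bar>multilinear_eval n (multilinear_coeff n f) z\<bar> \<le> r ^ d"
proof -
  have "multilinear_eval n (multilinear_coeff n f) (\<lambda>i. r * (z i / r))
      = r ^ d * multilinear_eval n (multilinear_coeff n f) (\<lambda>i. z i / r)"
    using hom by (intro multilinear_eval_scale) (auto simp: homogeneous_of_degree_def)
  moreover have "\<bar>multilinear_eval n (multilinear_coeff n f) (\<lambda>i. z i / r)\<bar> \<le> 1"
    using z r by (intro multilinear_eval_le_1 f) auto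
  ultimately show ?thesis
    using r by (simp add: abs_mult mult_left_le)
qed

section \<open>Partial derivatives and the chain rule\<close>

definition multilinear_partial :: "nat \<Rightarrow> (nat set \<Rightarrow> real) \<Rightarrow> nat \<Rightarrow> (nat \<Rightarrow> real) \<Rightarrow> real"
  where "multilinear_partial n c i x = (\<Sum>S\<in>{S\<in>Pow {..<n}. i \<in> S}. c S * (\<Prod>j\<in>S - {i}. x j))"

text \<open>Flipping coordinate \<open>i\<close> negates exactly the monomials containing
  \<open>i\<close>, so half the difference keeps these and cancels the others.\<close>

lemma partial_diff_eq:
  assumes x: "x \<in> cube n" and i: "i < n"
  shows "partial_diff i f x = x i * multilinear_partial n (multilinear_coeff n f) i x"
proof -
  let ?c = "multilinear_coeff n f"
  have mono: "(?c S * (\<Prod>j\<in>S. x j) - ?c S * (\<Prod>j\<in>S. flip i x j)) / 2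
      = (if i \<in> S then x i * (?c S * (\<Prod>j\<in>S - {i}. x j)) else 0)" if "S \<in> Pow {..<n}" for S
  proof (cases "i \<in> S")
    case True
    have fin: "finite S" using that finite_subset by auto
    have "(\<Prod>j\<in>S - {i}. flip i x j) = (\<Prod>j\<in>S - {i}. x j)"
      by (rule prod.cong) (auto simp: flip_def)
    then show ?thesis
      using True by (simp add: prod.remove[OF fin True] flip_def)
  next
    case False
    then have "(\<Prod>j\<in>S. flip i x j) = (\<Prod>j\<in>S. x j)"
      by (intro prod.cong) (auto simp: flip_def)
    with False show ?thesis by simp
  qed
  have "partial_diff i f x
      = (\<Sum>S\<in>Pow {..<n}. (?c S * (\<Prod>j\<in>S. x j) - ?c S * (\<Prod>j\<in>S. flip i x j)) / 2)"
    unfolding partial_diff_def multilinear_eval_coeff[OF x, of f, symmetric]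
      multilinear_eval_coeff[OF flip_cube[OF x i], of f, symmetric] multilinear_eval_def
    by (simp add: sum_subtractf sum_divide_distrib diff_divide_distrib)
  also have "\<dots> = (\<Sum>S\<in>Pow {..<n}. if i \<in> S then x i * (?c S * (\<Prod>j\<in>S - {i}. x j)) else 0)"
    using mono by (intro sum.cong) auto
  also have "\<dots> = x i * multilinear_partial n ?c i x"
    unfolding multilinear_partial_def sum_distrib_left by (rule sum.inter_filter[symmetric]) simp
  finally show ?thesis .
qed

text \<open>Chain rule along a complex curve. The curve is at a real point at \<open>z\<close>, so
  the gradient there is given by the real \<open>multilinear_partial\<close>.\<close>

lemma multilinear_eval_has_derivative:
  fixes g :: "nat \<Rightarrow> complex \<Rightarrow> complex"
  assumes g: "\<And>i. (g i has_field_derivative g' i) (at z)" and x: "\<And>i. g i z = of_real (x i)"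
  shows "((\<lambda>w. multilinear_eval n c (\<lambda>i. g i w)) has_field_derivative
           (\<Sum>i<n. g' i * of_real (multilinear_partial n c i x))) (at z)"
proof -
  have "((\<lambda>w. multilinear_eval n c (\<lambda>i. g i w)) has_field_derivative
      (\<Sum>S\<in>Pow {..<n}. of_real (c S) * (\<Sum>i\<in>S. g' i * (\<Prod>j\<in>S - {i}. g j z)))) (at z)"
    unfolding multilinear_eval_def
    by (intro DERIV_sum DERIV_cmult has_field_derivative_prod g)
  also have "(\<Sum>S\<in>Pow {..<n}. of_real (c S) * (\<Sum>i\<in>S. g' i * (\<Prod>j\<in>S - {i}. g j z)))
      = (\<Sum>S\<in>Pow {..<n}. \<Sum>i<n. if i \<in> S then g' i * of_real (c S * (\<Prod>j\<in>S - {i}. x j)) else 0)"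
  proof (rule sum.cong[OF refl])
    fix S assume "S \<in> Pow {..<n}"
    then have "S = {i\<in>{..<n}. i \<in> S}" by auto
    then have "(\<Sum>i\<in>S. g' i * of_real (c S * (\<Prod>j\<in>S - {i}. x j)))
        = (\<Sum>i<n. if i \<in> S then g' i * of_real (c S * (\<Prod>j\<in>S - {i}. x j)) else 0)"
      using sum.inter_filter[of "{..<n}" "\<lambda>i. g' i * of_real (c S * (\<Prod>j\<in>S - {i}. x j))" "\<lambda>i. i \<in> S"]
      by simp
    then show "of_real (c S) * (\<Sum>i\<in>S. g' i * (\<Prod>j\<in>S - {i}. g j z))
        = (\<Sum>i<n. if i \<in> S then g' i * of_real (c S * (\<Prod>j\<in>S - {i}. x j)) else 0)"
      by (simp add: x sum_distrib_left mult_ac)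
  qed
  also have "\<dots> = (\<Sum>i<n. g' i * of_real (multilinear_partial n c i x))"
    unfolding multilinear_partial_def of_real_sum sum_distrib_left
    by (subst sum.swap) (intro sum.cong refl sum.inter_filter[symmetric], simp)
  finally show ?thesis .
qed

section \<open>Bounds along the ellipse\<close>

text \<open>
  With \<open>z = e\<^sup>2\<^sup>i\<^sup>\<theta>\<close> this point is \<open>e\<^sup>i\<^sup>\<theta>\<close> times \<open>cos \<theta> x + b sin \<theta> y\<close>.
\<close>

definition ellipse_point :: "(nat \<Rightarrow> real) \<Rightarrow> (nat \<Rightarrow> real) \<Rightarrow> real \<Rightarrow> complex \<Rightarrow> nat \<Rightarrow> complex"
  where "ellipse_point x y b z i
    = of_real (x i) * ((z + 1) / 2) + of_real (b * y i) * ((z - 1) / (2 * \<i>))"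

lemma ellipse_point_has_derivative:
  "((\<lambda>z. ellipse_point x y b z i) has_field_derivative
     of_real (x i) / 2 + of_real (b * y i) / (2 * \<i>)) (at z)"
  unfolding ellipse_point_def by (auto intro!: derivative_eq_intros)

lemma multilinear_eval_ellipse_holomorphic:
  "(\<lambda>z. multilinear_eval n c (ellipse_point x y b z)) holomorphic_on A"
  unfolding multilinear_eval_def ellipse_point_def by (intro holomorphic_intros) auto

lemma multilinear_eval_ellipse_le:
  assumes f: "\<And>x. x \<in> cube n \<Longrightarrow> \<bar>f x\<bar> \<le> 1" and hom: "homogeneous_of_degree n d f" and d: "d > 0"
    and x: "x \<in> cube n" and y: "\<And>i. \<bar>y i\<bar> = 1" and b: "b\<^sup>2 = 1 / real d" and z: "norm z = 1"
  shows "norm (multilinear_eval n (multilinear_coeff n f) (ellipse_point x y b z)) \<le> 2"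
proof -
  let ?c = "multilinear_coeff n f" and ?r = "sqrt (1 + 1 / real d)"
  define t where "t = Arg z / 2"
  have t: "z = cis (2 * t)"
    using rcis_cmod_Arg[of z] z by (simp add: t_def rcis_def)
  define p where "p i = x i * cos t + b * y i * sin t" for i
  have sq: "cis (2 * t) = cis t * cis t" by (simp add: cis_mult)
  have inv: "cis t * cis (- t) = 1" by (simp add: cis_mult)
  have cos: "(z + 1) / 2 = cis t * of_real (cos t)"
  proof -
    have "of_real (cos t) = (cis t + cis (- t)) / 2" by (simp add: complex_eq_iff)
    then show ?thesis by (simp only: t sq times_divide_eq_right distrib_left inv)
  qed
  have sin: "(z - 1) / (2 * \<i>) = cis t * of_real (sin t)"
  proof -
    have "of_real (sin t) = (cis t - cis (- t)) / (2 * \<i>)"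
      by (simp add: complex_eq_iff Re_divide Im_divide)
    then show ?thesis by (simp only: t sq times_divide_eq_right right_diff_distrib inv)
  qed
  \<comment> \<open>The common factor has modulus 1 and comes out by homogeneity, so only the real
    point \<open>p\<close> has to be bounded.\<close>
  have "ellipse_point x y b z = (\<lambda>i. cis t * of_real (p i))"
    unfolding ellipse_point_def cos sin p_def by (simp add: algebra_simps)
  then have "multilinear_eval n ?c (ellipse_point x y b z)
      = cis t ^ d * multilinear_eval n ?c (\<lambda>i. of_real (p i))"
    using hom by (simp add: homogeneous_of_degree_def multilinear_eval_scale)
  then have "norm (multilinear_eval n ?c (ellipse_point x y b z)) = \<bar>multilinear_eval n ?c p\<bar>"
    by (simp add: multilinear_eval_of_real norm_mult norm_power)
  also have "\<dots> \<le> ?r ^ d"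
  proof (rule multilinear_eval_le_power[OF f hom])
    show "?r > 0" by (simp add: add_pos_nonneg)
    fix i assume "i < n"
    have xx: "(x i)\<^sup>2 = 1" using cube_sq[OF x \<open>i < n\<close>] by (simp add: power2_eq_square)
    have yy: "(y i)\<^sup>2 = 1" using y[of i] by (metis one_power2 power2_abs)
    \<comment> \<open>Lagrange's identity, which gives Cauchy-Schwarz after the second square is
      dropped.\<close>
    have "(p i)\<^sup>2 + (b * y i * cos t - x i * sin t)\<^sup>2
        = ((x i)\<^sup>2 + b\<^sup>2 * (y i)\<^sup>2) * ((sin t)\<^sup>2 + (cos t)\<^sup>2)"
      unfolding p_def by algebra
    then have "(p i)\<^sup>2 + (b * y i * cos t - x i * sin t)\<^sup>2 = 1 + 1 / real d"
      by (simp add: xx yy b)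
    then have "(p i)\<^sup>2 \<le> 1 + 1 / real d"
      using zero_le_power2[of "b * y i * cos t - x i * sin t"] by linarith
    then show "\<bar>p i\<bar> \<le> ?r" by (rule real_le_rsqrt[OF order_trans[OF eq_refl[OF power2_abs]]])
  qed
  also have "?r ^ d \<le> 2"
  proof (rule power2_le_imp_le)
    have "(?r ^ d)\<^sup>2 = (1 + 1 / real d) ^ d"
      by (simp only: power_commutes power2_eq_square flip: power_mult_distrib) simp
    then show "(?r ^ d)\<^sup>2 \<le> 2\<^sup>2"
      using one_plus_inverse_power_le_3[OF d] by simp
  qed simp
  finally show ?thesis .
qed

lemma directional_derivative_bound:
  assumes f: "\<And>x. x \<in> cube n \<Longrightarrow> \<bar>f x\<bar> \<le> 1" and hom: "homogeneous_of_degree n d f" and d: "d > 0"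
    and x: "x \<in> cube n" and y: "\<And>i. \<bar>y i\<bar> = 1"
  shows "(\<Sum>i<n. y i * multilinear_partial n (multilinear_coeff n f) i x) \<le> 12 * real d powr (3/2)"
proof -
  let ?c = "multilinear_coeff n f" and ?b = "1 / sqrt (real d)"
  let ?D = "\<lambda>i. multilinear_partial n ?c i x"
  define Q where "Q z = multilinear_eval n ?c (ellipse_point x y ?b z)" for z
  \<comment> \<open>Substituting 1/z and multiplying by \<open>z\<close> only changes the sign of
    \<open>?b\<close>, so the reversal is again of ellipse type and obeys the same bound.\<close>
  define R where "R z = multilinear_eval n ?c (ellipse_point x y (- ?b) z)" for z
  have b: "?b\<^sup>2 = 1 / real d" "(- ?b)\<^sup>2 = 1 / real d"
    using d by (auto simp: power_divide)
  have "norm (deriv Q 1) \<le> 3 * 2 * real d"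
  proof (rule Bernstein_inequality_reversal[where R = R])
    fix z :: complex assume "z \<noteq> 0"
    then have z: "z * ((1 / z + 1) / 2) = (z + 1) / 2"
        "z * ((1 / z - 1) / (2 * \<i>)) = - ((z - 1) / (2 * \<i>))"
      by (simp_all add: field_simps)
    have "ellipse_point x y ?b z i = z * ellipse_point x y (- ?b) (1 / z) i" for i
      unfolding ellipse_point_def distrib_left mult.left_commute[of z] z by simp
    then have "ellipse_point x y ?b z = (\<lambda>i. z * ellipse_point x y (- ?b) (1 / z) i)"
      by blast
    then show "Q z = z ^ d * R (1 / z)"
      using hom by (simp add: Q_def R_def homogeneous_of_degree_def multilinear_eval_scale)
  next
    fix z :: complex assume "norm z = 1"
    then show "norm (Q z) \<le> 2" "norm (R z) \<le> 2"
      unfolding Q_def R_def using b by (auto intro!: multilinear_eval_ellipse_le f hom d x y)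
  qed (use d in \<open>auto simp: Q_def[abs_def] R_def[abs_def] multilinear_eval_ellipse_holomorphic\<close>)
  moreover have "(Q has_field_derivative
      (\<Sum>i<n. (of_real (x i) / 2 + of_real (?b * y i) / (2 * \<i>)) * of_real (?D i))) (at 1)"
    unfolding Q_def
    by (intro multilinear_eval_has_derivative ellipse_point_has_derivative)
      (simp add: ellipse_point_def)
  ultimately have "norm (\<Sum>i<n. (of_real (x i) / 2 + of_real (?b * y i) / (2 * \<i>)) * of_real (?D i))
      \<le> 6 * real d" (is "norm ?s \<le> _")
    by (simp add: DERIV_imp_deriv)
  \<comment> \<open>The curve passes through \<open>x\<close> at 1, and its velocity there has real
    part along \<open>x\<close> and imaginary part along \<open>y\<close>. The imaginary part of the
    derivative thus isolates direction \<open>y\<close>; the factor \<open>?b / 2\<close> turns 6 d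
    into 12 d sqrt d.\<close>
  moreover have "Im ?s = - (\<Sum>i<n. y i * ?D i) * ?b / 2"
  proof -
    have "Im ((of_real (x i) / 2 + of_real (b * y i) / (2 * \<i>)) * of_real (?D i))
        = - (y i * ?D i) * b / 2" for b i
      by (simp add: Im_divide)
    then show ?thesis
      by (simp only: Im_sum sum_distrib_right sum_divide_distrib flip: sum_negf)
  qed
  ultimately have "(\<Sum>i<n. y i * ?D i) * ?b / 2 \<le> 6 * real d"
    using abs_Im_le_cmod[of ?s] by linarith
  then have "(\<Sum>i<n. y i * ?D i) \<le> 12 * (real d * sqrt (real d))"
    using d by (simp add: field_simps)
  also have "real d * sqrt (real d) = real d powr (3/2)"
    using d powr_add[of "real d" 1 "1/2"] by (simp add: powr_half_sqrt)
  finally show ?thesis .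
qed

section \<open>From directional derivatives to \<open>Delta\<close> and
  \<open>Inf_total\<close>\<close>

lemma Delta_bound:
  assumes f: "\<And>x. x \<in> cube n \<Longrightarrow> \<bar>f x\<bar> \<le> 1" and hom: "homogeneous_of_degree n d f"
    and x: "x \<in> cube n"
  shows "Delta n f x \<le> 12 * real d powr (3/2)"
proof -
  let ?D = "\<lambda>i. multilinear_partial n (multilinear_coeff n f) i x"
  have "\<bar>partial_diff i f x\<bar> = \<bar>?D i\<bar>" if "i < n" for i
    using partial_diff_eq[OF x that, of f] cube_coord[OF x that] by auto
  then have Delta: "Delta n f x = (\<Sum>i<n. \<bar>?D i\<bar>)"
    by (simp add: Delta_def)
  show ?thesis
  proof (cases "d = 0")
    \<comment> \<open>The ellipse needs \<open>d > 0\<close>. For degree 0 no monomial contains a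
      variable, and the bound reads 0 because \<open>0 powr (3/2) = 0\<close>.\<close>
    case True
    have "multilinear_coeff n f S = 0" if "S \<subseteq> {..<n}" "i \<in> S" for S i
      using hom that True finite_subset[OF that(1)] by (auto simp: homogeneous_of_degree_def)
    then have "?D i = 0" for i
      unfolding multilinear_partial_def by (intro sum.neutral) auto
    then show ?thesis by (simp add: Delta)
  next
    case False
    \<comment> \<open>The maximizing direction is the sign vector of the gradient, with sign 1 at
      zero so that every entry has modulus 1.\<close>
    have "(\<Sum>i<n. \<bar>?D i\<bar>) = (\<Sum>i<n. (if ?D i \<ge> 0 then 1 else - 1) * ?D i)"
      by (intro sum.cong) auto
    also have "\<dots> \<le> 12 * real d powr (3/2)"
      using False by (intro directional_derivative_bound[OF f hom _ x]) auto
    finally show ?thesis by (simp add: Delta)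
  qed
qed

lemma Delta_nonneg: "Delta n f x \<ge> 0"
  by (simp add: Delta_def sum_nonneg)

text \<open>Exchanging sum and expectation makes the total influence the mean of
  \<open>Delta n f\<close>, which is at most its maximum.\<close>

lemma Inf_total_le_sup_norm_Delta: "Inf_total n f \<le> sup_norm n (Delta n f)"
proof -
  have card: "card (cube n) > 0"
    by (simp add: card_gt_0_iff finite_cube cube_nonempty)
  have "Inf_total n f = (\<Sum>i<n. (\<Sum>x\<in>cube n. \<bar>partial_diff i f x\<bar>) / card (cube n))"
    unfolding Inf_total_def by (simp add: integral_pmf_of_set finite_cube cube_nonempty)
  also have "\<dots> = (\<Sum>x\<in>cube n. Delta n f x) / card (cube n)"
    unfolding Delta_def by (subst sum.swap) (simp add: sum_divide_distrib)
  also have "\<dots> \<le> (\<Sum>x\<in>cube n. sup_norm n (Delta n f)) / card (cube n)"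
  proof (intro divide_right_mono sum_mono)
    fix x assume "x \<in> cube n"
    then have "\<bar>Delta n f x\<bar> \<le> sup_norm n (Delta n f)"
      unfolding sup_norm_def by (intro Max_ge) (auto simp: finite_cube)
    then show "Delta n f x \<le> sup_norm n (Delta n f)" by linarith
  qed simp
  also have "\<dots> = sup_norm n (Delta n f)"
    using card by simp
  finally show ?thesis .
qed

theorem theorem5p1:
  shows "\<exists>C::real. \<forall>(n::nat) (d::nat) (f :: (nat \<Rightarrow> real) \<Rightarrow> real).
    (\<forall>x\<in>cube n. f x \<in> {-1..1}) \<and> homogeneous_of_degree n d f \<longrightarrow>
      Inf_total n f \<le> sup_norm n (Delta n f) \<and>
      sup_norm n (Delta n f) \<le> C * real d powr (3/2)"
proof (intro exI[of _ 12] allI impI conjI)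
  fix n d and f :: "(nat \<Rightarrow> real) \<Rightarrow> real"
  assume "(\<forall>x\<in>cube n. f x \<in> {-1..1}) \<and> homogeneous_of_degree n d f"
  then have f: "\<And>x. x \<in> cube n \<Longrightarrow> \<bar>f x\<bar> \<le> 1" and hom: "homogeneous_of_degree n d f"
    by (auto simp: abs_le_iff minus_le_iff)
  show "Inf_total n f \<le> sup_norm n (Delta n f)"
    by (rule Inf_total_le_sup_norm_Delta)
  show "sup_norm n (Delta n f) \<le> 12 * real d powr (3/2)"
    unfolding sup_norm_def
    by (subst Max_le_iff) (auto simp: finite_cube cube_nonempty Delta_nonneg Delta_bound[OF f hom])
qed

end
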